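(* Let $\beta>0$, $t\in\mathbb{R}$, and let $\{Z(t)\}_{t\in\mathbb{R}}$ be the moving maximum process generated by the double exponential density $\phi(x)=\frac{\beta}{2}e^{-\beta|x|}$. Then for all $w_1,w_2>0$, $$-\log P\{Z(0)\le w_1,\ Z(t)\le w_2\}=\frac{\beta}{2}\int_{-\infty}^{\infty}\max\left\{\frac{e^{-\beta|s|}}{w_1},\frac{e^{-\beta|s-t|}}{w_2}\right\}ds,$$ and this quantity is also equal to each of the following three expressions. (i) The function $$\begin{cases}\dfrac1{w_2}, & 0<w_2<e^{-\beta|t|}w_1,\\[2mm] \dfrac1{w_1}+\dfrac1{w_2}-\dfrac{e^{-\beta|t|/2}}{\sqrt{w_1w_2}}, & e^{-\beta|t|}w_1\le w_2<e^{\beta|t|}w_1,\\[2mm] \dfrac1{w_1}, & w_2\ge e^{\beta|t|}w_1.\end{cases}$$ (ii) $$\int_{\arctan(e^{-\beta|t|})}^{\arctan(e^{\beta|t|})}\max\left\{\frac{\sin\theta}{w_1},\frac{\cos\theta}{w_2}\right\}s(\theta)\,d\theta+\frac12\max\left\{\frac{e^{-\beta|t|}}{w_1},\frac1{w_2}\right\}+\frac12\max\left\{\frac1{w_1},\frac{e^{-\beta|t|}}{w_2}\right\},$$ where $s(\theta)=\dfrac{e^{-\beta|t|/2}}{4}(\sin\theta\cos\theta)^{-3/2}$. (iii) $\dfrac1{w_1}+\dfrac1{w_2}+\dfrac1{w_2}\,\chi\!\left(\dfrac{w_2}{w_1}\right)$, where for $s>0$ $$\chi(s)=\begin{cases}-s,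 & 0<s\le e^{-\beta|t|},\\ -e^{-\beta|t|/2}\sqrt{s}, & e^{-\beta|t|}<s\le e^{\beta|t|},\\ -1, & s>e^{\beta|t|}.\end{cases}$$
   Context: For a unimodal continuous probability density $\phi$ on $\mathbb{R}$, let $\{(X_j,Y_j)\}_{j\ge1}$ be the points of a homogeneous (unit intensity) Poisson process on $\mathbb{R}\times\mathbb{R}_+$. The moving maximum process generated by $\phi$ is $$Z(t):=\max_{j\ge1}\frac{\phi(X_j-t)}{Y_j},\qquad t\in\mathbb{R}.$$ It is stationary and simple max-stable, with finite-dimensional distributions $$P\{Z(t_1)\le x_1,\dots,Z(t_d)\le x_d\}=\exp\left\{-\int_{-\infty}^{\infty}\max_{1\le i\le d}\frac{\phi(s-t_i)}{x_i}\,ds\right\},\qquad t_i\in\mathbb{R},\ x_i>0.$$ *)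

theory Defs
  imports "HOL-Probability.Probability"
begin

text \<open>
  A point process is given by an enumeration \<open>P 0, P 1, ...\<close> of its points. Counting indices
  rather than points takes multiplicities into account; the count may be infinite.
\<close>

definition point_count :: "(nat \<Rightarrow> 'w \<Rightarrow> 'e) \<Rightarrow> 'e set \<Rightarrow> 'w \<Rightarrow> ennreal" where
  "point_count P B \<omega> = emeasure (count_space UNIV) {j. P j \<omega> \<in> B}"

locale poisson_process = prob_space M
  for M :: "'w measure" +
  fixes \<mu> :: "'e measure" and P :: "nat \<Rightarrow> 'w \<Rightarrow> 'e"
  assumes random_point: "\<And>j. random_variable \<mu> (P j)"
    and poisson_count: "\<And>B k. B \<in> sets \<mu> \<Longrightarrow> emeasure \<mu> B < \<infinity> \<Longrightarrow>
      prob {\<omega> \<in> space M. point_count P B \<omega> = of_nat k}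
        = exp (- measure \<mu> B) * measure \<mu> B ^ k / fact k"
    and indep_count: "\<And>(I :: nat set) B. finite I \<Longrightarrow> disjoint_family_on B I \<Longrightarrow>
      (\<And>i. i \<in> I \<Longrightarrow> B i \<in> sets \<mu> \<and> emeasure \<mu> (B i) < \<infinity>) \<Longrightarrow>
      indep_vars (\<lambda>_. borel) (\<lambda>i. point_count P (B i)) I"

text \<open>Unit intensity on the closed half plane; the boundary line almost surely carries no point.\<close>

definition unit_poisson_half_plane ::
    "'w measure \<Rightarrow> (nat \<Rightarrow> 'w \<Rightarrow> real) \<Rightarrow> (nat \<Rightarrow> 'w \<Rightarrow> real) \<Rightarrow> bool" where
  "unit_poisson_half_plane M X Y \<longleftrightarrow>
     poisson_process M (restrict_space lborel (UNIV \<times> {0..})) (\<lambda>j \<omega>. (X j \<omega>, Y j \<omega>))"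

text \<open>
  For a probability density \<open>\<phi>\<close> the maximum exists almost surely for each \<open>t\<close>, since only finitely
  many points satisfy \<open>\<phi> (X j \<omega> - t) / Y j \<omega> > \<epsilon>\<close>. Where there is no maximum, the value is an
  unspecified constant.
\<close>

definition moving_maximum ::
    "(real \<Rightarrow> real) \<Rightarrow> (nat \<Rightarrow> 'w \<Rightarrow> real) \<Rightarrow> (nat \<Rightarrow> 'w \<Rightarrow> real) \<Rightarrow> real \<Rightarrow> 'w \<Rightarrow> real" where
  "moving_maximum \<phi> X Y t \<omega> = (GREATEST z. z \<in> range (\<lambda>j. \<phi> (X j \<omega> - t) / Y j \<omega>))"

definition double_exponential_density :: "real \<Rightarrow> real \<Rightarrow> real" where
  "double_exponential_density \<beta> x = \<beta> / 2 * exp (- \<beta> * \<bar>x\<bar>)"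

definition spectral_density :: "real \<Rightarrow> real \<Rightarrow> real \<Rightarrow> real" where
  "spectral_density \<beta> t \<theta> = exp (- \<beta> * \<bar>t\<bar> / 2) / 4 * (sin \<theta> * cos \<theta>) powr (- 3 / 2)"

text \<open>Only arguments \<open>s > 0\<close> are meaningful.\<close>

definition chi :: "real \<Rightarrow> real \<Rightarrow> real \<Rightarrow> real" where
  "chi \<beta> t s =
     (if s \<le> exp (- \<beta> * \<bar>t\<bar>) then - s
      else if s \<le> exp (\<beta> * \<bar>t\<bar>) then - exp (- \<beta> * \<bar>t\<bar> / 2) * sqrt s
      else - 1)"

end

theory Submission
  imports Defs
begin

text \<open>
  Almost surely the maximum defining \<open>Z(t)\<close> is attained: some level set
  \<open>{(x, y). \<phi> (x - t) / y > 1 / n}\<close> contains a point, and each contains only finitely many. Hence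
  \<open>Z(0) \<le> w\<^sub>1\<close> and \<open>Z(t) \<le> w\<^sub>2\<close> hold iff no point lies below the graph of
  \<open>max (\<phi>(s) / w\<^sub>1) (\<phi>(s - t) / w\<^sub>2)\<close>, and the void probability is \<open>exp (- area)\<close>. The
  integral over angles has the primitives \<open>2 * sqrt (tan \<theta>)\<close> and \<open>- 2 / sqrt (tan \<theta>)\<close>, up to
  constant factors, on the two sides of \<open>tan \<theta> = w\<^sub>1 / w\<^sub>2\<close>.
\<close>

section \<open>Void probabilities and finiteness of Poisson counts\<close>

context poisson_process
begin

text \<open>Measurability of a count is contained in \<open>indep_vars\<close>, so independence of a
  one-element family already yields it.\<close>

lemma borel_measurable_point_count:
  assumes "B \<in> sets \<mu>" "emeasure \<mu> B < \<infinity>"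
  shows "point_count P B \<in> borel_measurable M"
proof -
  have "indep_vars (\<lambda>_. borel) (\<lambda>i. point_count P B) {0 :: nat}"
    using indep_count[of "{0}" "\<lambda>_. B"] assms by (simp add: disjoint_family_on_def)
  then show ?thesis
    by (simp add: indep_vars_def)
qed

lemma void_probability:
  assumes "B \<in> sets \<mu>" "emeasure \<mu> B < \<infinity>"
  shows "prob {\<omega> \<in> space M. \<forall>j. P j \<omega> \<notin> B} = exp (- measure \<mu> B)"
proof -
  have "point_count P B \<omega> = of_nat 0 \<longleftrightarrow> (\<forall>j. P j \<omega> \<notin> B)" for \<omega>
    by (auto simp: point_count_def emeasure_count_space_eq_0)
  then show ?thesis
    using poisson_count[OF assms, of 0] by simp
qed

text \<open>The Poisson weights over all natural numbers sum to 1 by the exponential series. This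
  leaves probability 0 for the value infinity of the count.\<close>

lemma AE_finite_points:
  assumes "B \<in> sets \<mu>" "emeasure \<mu> B < \<infinity>"
  shows "AE \<omega> in M. finite {j. P j \<omega> \<in> B}"
proof -
  define A where "A k = {\<omega> \<in> space M. point_count P B \<omega> = of_nat k}" for k
  have A: "A k \<in> events" for k
    using borel_measurable_point_count[OF assms] unfolding A_def by measurable
  have "(\<lambda>k. prob (A k)) sums prob (\<Union>k. A k)"
    using A by (intro finite_measure_UNION) (auto simp: disjoint_family_on_def A_def)
  moreover have "(\<lambda>k. prob (A k)) sums (exp (- measure \<mu> B) * exp (measure \<mu> B))"
    using sums_mult[OF exp_converges[of "measure \<mu> B"], of "exp (- measure \<mu> B)"]
    by (simp add: A_def poisson_count[OF assms] field_simps)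
  ultimately have "prob (\<Union>k. A k) = 1"
    by (metis sums_unique2 exp_minus_inverse mult.commute)
  then have "AE \<omega> in M. \<omega> \<in> (\<Union>k. A k)"
    by (rule AE_prob_1)
  then show ?thesis
  proof eventually_elim
    case (elim \<omega>)
    then obtain k where "emeasure (count_space UNIV) {j. P j \<omega> \<in> B} = of_nat k"
      by (auto simp: A_def point_count_def)
    then show ?case
      by (metis emeasure_count_space_infinite subset_UNIV ennreal_of_nat_neq_top infinity_ennreal_def)
  qed
qed

end

section \<open>Regions below a graph in the half plane\<close>

text \<open>By Fubini the area is the integral of the lengths of the vertical slices, which are the
  intervals \<open>{0<..<h x}\<close>.\<close>

lemma hypograph_half_plane:
  fixes h :: "real \<Rightarrow> real"
  assumes [measurable]: "h \<in> borel_measurable borel" and nonneg: "\<And>x. 0 \<le> h x"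
  shows sets_hypograph_half_plane:
      "{(x, y). 0 < y \<and> y < h x} \<in> sets (restrict_space lborel (UNIV \<times> {0..}))"
    and emeasure_hypograph_half_plane:
      "emeasure (restrict_space lborel (UNIV \<times> {0..})) {(x, y). 0 < y \<and> y < h x}
        = (\<integral>\<^sup>+x. ennreal (h x) \<partial>lborel)"
proof -
  let ?H = "{(x, y). 0 < y \<and> y < h x}"
  have H: "?H \<in> sets (borel \<Otimes>\<^sub>M borel)"
  proof -
    have "{p \<in> space (borel \<Otimes>\<^sub>M borel). 0 < snd p \<and> snd p < h (fst p)} \<in> sets (borel \<Otimes>\<^sub>M borel)"
      by measurable
    then show ?thesis by (simp add: space_pair_measure case_prod_beta')
  qed
  have S: "UNIV \<times> {0..} \<in> sets (lborel :: (real \<times> real) measure)"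
    by (simp add: closed_Times)
  have sub: "?H \<subseteq> UNIV \<times> {0..}" by auto
  have Hl: "?H \<in> sets lborel" using H unfolding sets_lborel borel_prod .
  show "?H \<in> sets (restrict_space lborel (UNIV \<times> {0..}))"
    using S Hl sub by (subst sets_restrict_space_iff) auto
  have "emeasure (restrict_space lborel (UNIV \<times> {0..})) ?H = emeasure lborel ?H"
    using S sub by (intro emeasure_restrict_space) auto
  also have "\<dots> = emeasure (lborel \<Otimes>\<^sub>M lborel) ?H"
    by (simp add: lborel_prod)
  also have "\<dots> = (\<integral>\<^sup>+x. emeasure lborel (Pair x -` ?H) \<partial>lborel)"
    using H by (intro lborel.emeasure_pair_measure_alt) (simp add: borel_prod lborel_prod)
  also have "\<dots> = (\<integral>\<^sup>+x. ennreal (h x) \<partial>lborel)"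
  proof (intro nn_integral_cong)
    fix x
    have "Pair x -` ?H = {0<..<h x}" by auto
    then show "emeasure lborel (Pair x -` ?H) = ennreal (h x)"
      using nonneg[of x] by simp
  qed
  finally show "emeasure (restrict_space lborel (UNIV \<times> {0..})) ?H
      = (\<integral>\<^sup>+x. ennreal (h x) \<partial>lborel)" .
qed

section \<open>The moving maximum as a random variable\<close>

lemma moving_maximum_le_iff:
  assumes "\<exists>j. \<forall>k. \<phi> (X k \<omega> - t) / Y k \<omega> \<le> \<phi> (X j \<omega> - t) / Y j \<omega>"
  shows "moving_maximum \<phi> X Y t \<omega> \<le> w \<longleftrightarrow> (\<forall>k. \<phi> (X k \<omega> - t) / Y k \<omega> \<le> w)"
proof -
  from assms obtain j where j: "\<And>k. \<phi> (X k \<omega> - t) / Y k \<omega> \<le> \<phi> (X j \<omega> - t) / Y j \<omega>"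
    by auto
  then have "moving_maximum \<phi> X Y t \<omega> = \<phi> (X j \<omega> - t) / Y j \<omega>"
    unfolding moving_maximum_def by (intro Greatest_equality) auto
  with j show ?thesis by (auto intro: order_trans)
qed

text \<open>Without a maximum the predicate under the description operator is false for every
  \<open>z\<close>. The default value is therefore one constant, the same for all \<omega>, and this
  makes the process measurable everywhere and not only almost surely.\<close>

lemma moving_maximum_no_max:
  assumes "\<not> (\<exists>j. \<forall>k. \<phi> (X k \<omega> - t) / Y k \<omega> \<le> \<phi> (X j \<omega> - t) / Y j \<omega>)"
  shows "moving_maximum \<phi> X Y t \<omega> = (THE z. False)"
proof -
  have "z \<in> range (\<lambda>j. \<phi> (X j \<omega> - t) / Y j \<omega>)
      \<and> (\<forall>y. y \<in> range (\<lambda>j. \<phi> (X j \<omega> - t) / Y j \<omega>) \<longrightarrow> y \<le> z) \<longleftrightarrow> False" for z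
    using assms by auto
  then show ?thesis
    unfolding moving_maximum_def Greatest_def by (simp only:)
qed

text \<open>A sublevel set is described by countable quantifiers over indices. On the part without a
  maximum the condition is independent of \<omega>.\<close>

lemma borel_measurable_moving_maximum:
  assumes [measurable]: "\<phi> \<in> borel_measurable borel"
    "\<And>j. X j \<in> borel_measurable M" "\<And>j. Y j \<in> borel_measurable M"
  shows "moving_maximum \<phi> X Y t \<in> borel_measurable M"
proof (rule borel_measurable_iff_le[THEN iffD2], intro allI)
  fix w
  let ?f = "\<lambda>\<omega> j. \<phi> (X j \<omega> - t) / Y j \<omega>"
  have "{\<omega> \<in> space M. moving_maximum \<phi> X Y t \<omega> \<le> w} =
    {\<omega> \<in> space M. if \<exists>j. \<forall>k. ?f \<omega> k \<le> ?f \<omega> j then \<forall>k. ?f \<omega> k \<le> w else (THE z. False) \<le> w}"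
  proof (intro Collect_cong conj_cong refl)
    fix \<omega>
    show "moving_maximum \<phi> X Y t \<omega> \<le> w \<longleftrightarrow>
      (if \<exists>j. \<forall>k. ?f \<omega> k \<le> ?f \<omega> j then \<forall>k. ?f \<omega> k \<le> w else (THE z. False) \<le> w)"
      using moving_maximum_le_iff[of \<phi> X \<omega> t Y w] moving_maximum_no_max[of \<phi> X \<omega> t Y] by presburger
  qed
  also have "\<dots> \<in> sets M" by measurable
  finally show "{\<omega> \<in> space M. moving_maximum \<phi> X Y t \<omega> \<le> w} \<in> sets M" .
qed

text \<open>At \<open>y = 0\<close> both sides are false, the left one because
  \<open>a / 0 = 0\<close>. Points on the boundary line thus need no separate treatment.\<close>

lemma less_divide_half_plane_iff:
  fixes w y :: real
  assumes "0 < w" "0 \<le> y" "0 \<le> a"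
  shows "w < a / y \<longleftrightarrow> 0 < y \<and> y < a / w"
  using assms by (cases "y = 0") (auto simp: field_simps)

lemma unit_poisson_half_plane_measurable:
  assumes "unit_poisson_half_plane M X Y"
  shows "X j \<in> borel_measurable M" "Y j \<in> borel_measurable M"
    and "\<omega> \<in> space M \<Longrightarrow> 0 \<le> Y j \<omega>"
proof -
  interpret poisson_process M "restrict_space lborel (UNIV \<times> {0..})" "\<lambda>j \<omega>. (X j \<omega>, Y j \<omega>)"
    using assms by (simp add: unit_poisson_half_plane_def)
  have *: "(\<lambda>\<omega>. (X j \<omega>, Y j \<omega>)) \<in> M \<rightarrow>\<^sub>M borel"
    and "(\<lambda>\<omega>. (X j \<omega>, Y j \<omega>)) \<in> space M \<rightarrow> UNIV \<times> {0..}"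
    using random_point[of j] by (auto simp: measurable_restrict_space2_iff)
  then show "\<omega> \<in> space M \<Longrightarrow> 0 \<le> Y j \<omega>" by auto
  from * have "(\<lambda>\<omega>. (X j \<omega>, Y j \<omega>)) \<in> M \<rightarrow>\<^sub>M borel \<Otimes>\<^sub>M borel"
    by (simp add: borel_prod)
  from measurable_compose[OF this measurable_fst] measurable_compose[OF this measurable_snd]
  show "X j \<in> borel_measurable M" "Y j \<in> borel_measurable M" by simp_all
qed

lemma nn_integral_shift:
  fixes h :: "real \<Rightarrow> real"
  assumes "h \<in> borel_measurable borel"
  shows "(\<integral>\<^sup>+x. ennreal (h (x - t)) \<partial>lborel) = (\<integral>\<^sup>+x. ennreal (h x) \<partial>lborel)"
  using nn_integral_real_affine[of "\<lambda>x. ennreal (h x)" 1 "-t"] assms by (simp add: add.commute)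

lemma AE_moving_maximum_attained:
  fixes \<phi> :: "real \<Rightarrow> real"
  assumes pp: "unit_poisson_half_plane M X Y"
    and \<phi>: "\<phi> \<in> borel_measurable borel" "\<And>x. 0 \<le> \<phi> x" "(\<integral>\<^sup>+x. ennreal (\<phi> x) \<partial>lborel) = 1"
  shows "AE \<omega> in M. \<exists>j. \<forall>k. \<phi> (X k \<omega> - t) / Y k \<omega> \<le> \<phi> (X j \<omega> - t) / Y j \<omega>"
proof -
  let ?HP = "restrict_space lborel (UNIV \<times> {0..}) :: (real \<times> real) measure"
  let ?f = "\<lambda>\<omega> j. \<phi> (X j \<omega> - t) / Y j \<omega>"
  interpret poisson_process M ?HP "\<lambda>j \<omega>. (X j \<omega>, Y j \<omega>)"
    using pp by (simp add: unit_poisson_half_plane_def)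
  note [measurable] = \<phi>(1) unit_poisson_half_plane_measurable(1,2)[OF pp]
  \<comment> \<open>\<open>B n\<close> collects the points whose ratio exceeds the level
    \<open>1 / Suc n\<close>. Its area is \<open>Suc n\<close>: finite for each \<open>n\<close>,
    but unbounded in \<open>n\<close>.\<close>
  define B where "B n = {(x, y). 0 < y \<and> y < \<phi> (x - t) / (1 / real (Suc n))}" for n
  have B: "B n \<in> sets ?HP" for n
    unfolding B_def by (intro sets_hypograph_half_plane) (auto simp: \<phi>)
  have eB: "emeasure ?HP (B n) = ennreal (Suc n)" for n
  proof -
    have "emeasure ?HP (B n) = (\<integral>\<^sup>+x. ennreal (\<phi> (x - t) / (1 / real (Suc n))) \<partial>lborel)"
      unfolding B_def by (intro emeasure_hypograph_half_plane) (auto simp: \<phi>)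
    also have "\<dots> = (\<integral>\<^sup>+x. ennreal (\<phi> x / (1 / real (Suc n))) \<partial>lborel)"
      by (rule nn_integral_shift[of "\<lambda>x. \<phi> x / (1 / real (Suc n))"]) simp
    also have "\<dots> = (\<integral>\<^sup>+x. ennreal (Suc n) * ennreal (\<phi> x) \<partial>lborel)"
      by (intro nn_integral_cong) (simp add: ennreal_mult' \<phi> mult.commute del: of_nat_Suc)
    also have "\<dots> = ennreal (Suc n)"
      by (subst nn_integral_cmult) (auto simp: \<phi>)
    finally show ?thesis .
  qed
  have inB: "(X j \<omega>, Y j \<omega>) \<in> B n \<longleftrightarrow> 1 / real (Suc n) < ?f \<omega> j" if "\<omega> \<in> space M" for \<omega> j n
    unfolding B_def
    using less_divide_half_plane_iff[of "1 / real (Suc n)" "Y j \<omega>" "\<phi> (X j \<omega> - t)"]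
      unit_poisson_half_plane_measurable(3)[OF pp that] \<phi>(2) by auto
  define N where "N = {\<omega> \<in> space M. \<forall>n j. (X j \<omega>, Y j \<omega>) \<notin> B n}"
  have void: "{\<omega> \<in> space M. \<forall>j. (X j \<omega>, Y j \<omega>) \<notin> B n} \<in> events" for n
  proof -
    have "{\<omega> \<in> space M. \<forall>j. (X j \<omega>, Y j \<omega>) \<notin> B n} = {\<omega> \<in> space M. \<forall>j. \<not> 1 / real (Suc n) < ?f \<omega> j}"
      using inB by auto
    also have "\<dots> \<in> events" by measurable
    finally show ?thesis .
  qed
  \<comment> \<open>\<open>N\<close> is contained in every void event, so these bounds, which tend
    to 0, force it to be a null set.\<close>
  have "prob N \<le> exp (- real (Suc n))" for n
  proof -
    have "prob N \<le> prob {\<omega> \<in> space M. \<forall>j. (X j \<omega>, Y j \<omega>) \<notin> B n}"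
      by (intro finite_measure_mono void) (auto simp: N_def)
    also have "\<dots> = exp (- real (Suc n))"
      using void_probability[OF B[of n]] eB[of n] by (simp add: measure_def del: of_nat_Suc)
    finally show ?thesis .
  qed
  moreover have "(\<lambda>n. exp (- real (Suc n))) \<longlonglongrightarrow> 0"
    by real_asymp
  ultimately have "prob N \<le> 0"
    by (intro LIMSEQ_le_const) auto
  moreover have N: "N \<in> events"
  proof -
    have "N = (\<Inter>n. {\<omega> \<in> space M. \<forall>j. (X j \<omega>, Y j \<omega>) \<notin> B n})" by (auto simp: N_def)
    then show ?thesis using void by auto
  qed
  ultimately have "AE \<omega> in M. \<omega> \<notin> N"
    by (intro AE_not_in) (auto simp: null_sets_def emeasure_eq_measure measure_le_0_iff)
  moreover have "AE \<omega> in M. \<forall>n. finite {j. (X j \<omega>, Y j \<omega>) \<in> B n}"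
    using B eB by (simp add: AE_all_countable AE_finite_points del: of_nat_Suc)
  moreover have "AE \<omega> in M. \<omega> \<in> space M" by (rule AE_space)
  ultimately show ?thesis
  proof eventually_elim
    case (elim \<omega>)
    then obtain n j0 where j0: "(X j0 \<omega>, Y j0 \<omega>) \<in> B n" by (auto simp: N_def)
    \<comment> \<open>The finitely many indices above the level \<open>1 / Suc n\<close> have a
      largest ratio. Every other index stays at or below that level, so this ratio is the overall
      maximum.\<close>
    let ?J = "{j. (X j \<omega>, Y j \<omega>) \<in> B n}"
    have fin: "finite (?f \<omega> ` ?J)" "?f \<omega> ` ?J \<noteq> {}" using elim j0 by auto
    from Max_in[OF fin] obtain j where j: "j \<in> ?J" "Max (?f \<omega> ` ?J) = ?f \<omega> j" by auto
    have "?f \<omega> k \<le> ?f \<omega> j" for k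
    proof (cases "k \<in> ?J")
      case True
      then show ?thesis using Max_ge[OF fin(1), of "?f \<omega> k"] j by auto
    next
      case False
      then show ?thesis using inB[OF elim(3), of k n] inB[OF elim(3), of j n] j(1) by auto
    qed
    then show ?case by auto
  qed
qed

section \<open>Two-dimensional distributions\<close>

lemma prob_moving_maximum_le:
  fixes \<phi> :: "real \<Rightarrow> real"
  assumes pp: "unit_poisson_half_plane M X Y"
    and \<phi>: "\<phi> \<in> borel_measurable borel" "\<And>x. 0 \<le> \<phi> x" "(\<integral>\<^sup>+x. ennreal (\<phi> x) \<partial>lborel) = 1"
    and w: "0 < w1" "0 < w2"
  shows "measure M {\<omega> \<in> space M. moving_maximum \<phi> X Y t1 \<omega> \<le> w1 \<and> moving_maximum \<phi> X Y t2 \<omega> \<le> w2}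
    = exp (- (LBINT s. max (\<phi> (s - t1) / w1) (\<phi> (s - t2) / w2)))"
proof -
  let ?HP = "restrict_space lborel (UNIV \<times> {0..}) :: (real \<times> real) measure"
  let ?f = "\<lambda>\<omega> t j. \<phi> (X j \<omega> - t) / Y j \<omega>"
  let ?h = "\<lambda>s. max (\<phi> (s - t1) / w1) (\<phi> (s - t2) / w2)"
  interpret poisson_process M ?HP "\<lambda>j \<omega>. (X j \<omega>, Y j \<omega>)"
    using pp by (simp add: unit_poisson_half_plane_def)
  note [measurable] = \<phi>(1) unit_poisson_half_plane_measurable(1,2)[OF pp]
  have [measurable]: "moving_maximum \<phi> X Y t \<in> borel_measurable M" for t
    by (rule borel_measurable_moving_maximum) measurable
  have h: "?h \<in> borel_measurable borel" "\<And>s. 0 \<le> ?h s"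
    using \<phi> w by (auto simp: le_max_iff_disj)
  have int: "integrable lborel (\<lambda>s. \<phi> (s - t) / w)" for t w
    using \<phi> nn_integral_shift[OF \<phi>(1), of t] by (auto intro!: integrable_divide_zero integrableI_nonneg)
  then have inth: "integrable lborel ?h" by (intro integrable_max)
  define A where "A = {(x, y). 0 < y \<and> y < ?h x}"
  have A: "A \<in> sets ?HP"
    unfolding A_def by (intro sets_hypograph_half_plane h)
  have eA: "emeasure ?HP A = ennreal (LBINT s. ?h s)"
    unfolding A_def using inth h
    by (subst emeasure_hypograph_half_plane) (auto simp: nn_integral_eq_integral)
  have inA: "(X j \<omega>, Y j \<omega>) \<notin> A \<longleftrightarrow> ?f \<omega> t1 j \<le> w1 \<and> ?f \<omega> t2 j \<le> w2"
    if "\<omega> \<in> space M" for \<omega> j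
    using less_divide_half_plane_iff[OF w(1), of "Y j \<omega>" "\<phi> (X j \<omega> - t1)"]
      less_divide_half_plane_iff[OF w(2), of "Y j \<omega>" "\<phi> (X j \<omega> - t2)"]
      unit_poisson_half_plane_measurable(3)[OF pp that, of j] \<phi>(2)
    by (auto simp: A_def less_max_iff_disj not_less[symmetric])
  \<comment> \<open>The two events agree wherever both maxima are attained, hence up to a null set.
    The second event says that \<open>A\<close> contains no point.\<close>
  have "prob {\<omega> \<in> space M. moving_maximum \<phi> X Y t1 \<omega> \<le> w1 \<and> moving_maximum \<phi> X Y t2 \<omega> \<le> w2}
    = prob {\<omega> \<in> space M. \<forall>j. ?f \<omega> t1 j \<le> w1 \<and> ?f \<omega> t2 j \<le> w2}"
  proof (rule finite_measure_eq_AE)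
    show "AE \<omega> in M. (\<omega> \<in> {\<omega> \<in> space M. moving_maximum \<phi> X Y t1 \<omega> \<le> w1 \<and> moving_maximum \<phi> X Y t2 \<omega> \<le> w2})
      = (\<omega> \<in> {\<omega> \<in> space M. \<forall>j. ?f \<omega> t1 j \<le> w1 \<and> ?f \<omega> t2 j \<le> w2})"
      using AE_moving_maximum_attained[OF pp \<phi>, of t1] AE_moving_maximum_attained[OF pp \<phi>, of t2]
      by eventually_elim (auto simp only: moving_maximum_le_iff mem_Collect_eq)
  qed measurable
  also have "{\<omega> \<in> space M. \<forall>j. ?f \<omega> t1 j \<le> w1 \<and> ?f \<omega> t2 j \<le> w2}
      = {\<omega> \<in> space M. \<forall>j. (X j \<omega>, Y j \<omega>) \<notin> A}"
    using inA by auto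
  also have "prob \<dots> = exp (- measure ?HP A)"
    using A eA by (intro void_probability) auto
  also have "measure ?HP A = (LBINT s. ?h s)"
    using eA h by (simp add: measure_def integral_nonneg_AE)
  finally show ?thesis .
qed

section \<open>Closed form of the integral over the line\<close>

text \<open>This one-sided tail is the building block: the integrals of exponentials below arise
  from it by reflections, sums and scaling.\<close>

lemma has_bochner_integral_exp_tail:
  fixes a \<beta> :: real
  assumes "0 < \<beta>"
  shows "has_bochner_integral lborel (\<lambda>s. indicator {a..} s * exp (- \<beta> * s)) (exp (- \<beta> * a) / \<beta>)"
proof (rule has_bochner_integral_nn_integral)
  have "(\<integral>\<^sup>+ x. ennreal (exp (- \<beta> * x)) * indicator {a..} x \<partial>lborel)
      = ennreal (0 - (- exp (- \<beta> * a) / \<beta>))"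
  proof (rule nn_integral_FTC_atLeast[where F = "\<lambda>x. - exp (- \<beta> * x) / \<beta>"])
    show "((\<lambda>x. - exp (- \<beta> * x) / \<beta>) \<longlongrightarrow> 0) at_top"
      using assms by real_asymp
  qed (use assms in \<open>auto intro!: derivative_eq_intros\<close>)
  moreover have "(\<integral>\<^sup>+ x. ennreal (indicator {a..} x * exp (- \<beta> * x)) \<partial>lborel)
      = (\<integral>\<^sup>+ x. ennreal (exp (- \<beta> * x)) * indicator {a..} x \<partial>lborel)"
    by (intro nn_integral_cong) (simp split: split_indicator)
  ultimately show "(\<integral>\<^sup>+ x. ennreal (indicator {a..} x * exp (- \<beta> * x)) \<partial>lborel) = ennreal (exp (- \<beta> * a) / \<beta>)"
    by simp
qed (use assms in auto)

lemma has_bochner_integral_reflect: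
  fixes f :: "real \<Rightarrow> real"
  assumes "has_bochner_integral lborel f I"
  shows "has_bochner_integral lborel (\<lambda>s. f (t - s)) I"
  using lborel_has_bochner_integral_real_affine_iff[of "-1" f I t] assms by simp

lemma has_bochner_integral_double_exp:
  fixes \<beta> :: real
  assumes "0 < \<beta>"
  shows "has_bochner_integral lborel (\<lambda>s. exp (- \<beta> * \<bar>s - t\<bar>)) (2 / \<beta>)"
proof -
  have T: "has_bochner_integral lborel (\<lambda>s. indicator {0..} s * exp (- \<beta> * s)) (1 / \<beta>)"
    using has_bochner_integral_exp_tail[OF assms, of 0] by simp
  \<comment> \<open>Two successive reflections compose to a translation, since
    \<open>0 - (t - s) = s - t\<close>. The summands are the tails to the left and to the right of
    \<open>t\<close>.\<close>
  have "has_bochner_integral lborel (\<lambda>s. indicator {0..} (t - s) * exp (- \<beta> * (t - s))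
      + indicator {0..} (0 - (t - s)) * exp (- \<beta> * (0 - (t - s)))) (1 / \<beta> + 1 / \<beta>)"
    by (intro has_bochner_integral_add has_bochner_integral_reflect[OF T]
        has_bochner_integral_reflect[OF has_bochner_integral_reflect[OF T, of 0]])
  then have "has_bochner_integral lborel (\<lambda>s. exp (- \<beta> * \<bar>s - t\<bar>)) (1 / \<beta> + 1 / \<beta>)"
  proof (rule has_bochner_integral_cong_AE[THEN iffD1, rotated 3])
    \<comment> \<open>At \<open>s = t\<close> both indicators equal 1 and the sum counts the value
      twice, so that single point is left out.\<close>
    show "AE s in lborel. indicator {0..} (t - s) * exp (- \<beta> * (t - s))
      + indicator {0..} (0 - (t - s)) * exp (- \<beta> * (0 - (t - s))) = exp (- \<beta> * \<bar>s - t\<bar>)"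
      using AE_lborel_singleton[of t] by eventually_elim (auto split: split_indicator)
  qed measurable
  then show ?thesis by simp
qed

lemma exp_half_sqrt: "exp (x / 2) = sqrt (exp x)" for x :: real
  by (rule real_sqrt_unique[symmetric]) (simp_all add: power2_eq_square exp_add[symmetric])

text \<open>Since \<open>\<bar>s\<bar>\<close> and \<open>\<bar>s - t\<bar>\<close> differ by at
  most \<open>t\<close>, in the two outer cases one function dominates on the whole line and only
  its integral remains. A genuine crossing occurs only in the middle case.\<close>

lemma integral_max_double_exp_nonneg:
  fixes \<beta> t :: real
  assumes \<beta>: "0 < \<beta>" and t: "0 \<le> t" and w: "0 < w1" "0 < w2"
  shows "\<beta> / 2 * (LBINT s. max (exp (- \<beta> * \<bar>s\<bar>) / w1) (exp (- \<beta> * \<bar>s - t\<bar>) / w2)) =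
     (if w2 < exp (- \<beta> * t) * w1 then 1 / w2
      else if w2 < exp (\<beta> * t) * w1 then 1 / w1 + 1 / w2 - exp (- \<beta> * t / 2) / sqrt (w1 * w2)
      else 1 / w1)"
proof -
  let ?f = "\<lambda>s. max (exp (- \<beta> * \<bar>s\<bar>) / w1) (exp (- \<beta> * \<bar>s - t\<bar>) / w2)"
  have I1: "has_bochner_integral lborel (\<lambda>s. exp (- \<beta> * \<bar>s\<bar>) / w1) (2 / \<beta> / w1)"
    using has_bochner_integral_double_exp[OF \<beta>, of 0] by (intro has_bochner_integral_divide_zero) simp
  have I2: "has_bochner_integral lborel (\<lambda>s. exp (- \<beta> * \<bar>s - t\<bar>) / w2) (2 / \<beta> / w2)"
    using has_bochner_integral_double_exp[OF \<beta>] by (intro has_bochner_integral_divide_zero)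
  consider (lo) "w2 < exp (- \<beta> * t) * w1" | (hi) "exp (\<beta> * t) * w1 \<le> w2"
    | (mid) "exp (- \<beta> * t) * w1 \<le> w2" "w2 < exp (\<beta> * t) * w1" by linarith
  then show ?thesis
  proof cases
    case lo
    have "exp (- \<beta> * \<bar>s\<bar>) / w1 \<le> exp (- \<beta> * \<bar>s - t\<bar>) / w2" for s
    proof -
      have "exp (- \<beta> * \<bar>s\<bar>) * w2 \<le> exp (- \<beta> * \<bar>s\<bar>) * (exp (- \<beta> * t) * w1)"
        using lo by simp
      also have "\<dots> = exp (- \<beta> * (\<bar>s\<bar> + t)) * w1"
        by (simp add: exp_add[symmetric] algebra_simps)
      also have "\<dots> \<le> exp (- \<beta> * \<bar>s - t\<bar>) * w1"
        using \<beta> t w by (intro mult_right_mono) auto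
      finally show ?thesis using w by (simp add: field_simps)
    qed
    then have "?f = (\<lambda>s. exp (- \<beta> * \<bar>s - t\<bar>) / w2)"
      by (intro ext max_absorb2)
    then show ?thesis using lo \<beta> has_bochner_integral_integral_eq[OF I2] by simp
  next
    case hi
    have "exp (- \<beta> * \<bar>s - t\<bar>) / w2 \<le> exp (- \<beta> * \<bar>s\<bar>) / w1" for s
    proof -
      have "exp (- \<beta> * \<bar>s - t\<bar>) * w1 \<le> exp (- \<beta> * (\<bar>s\<bar> - t)) * w1"
        using \<beta> t w by (intro mult_right_mono) auto
      also have "\<dots> = exp (- \<beta> * \<bar>s\<bar>) * (exp (\<beta> * t) * w1)"
        by (simp add: exp_add[symmetric] algebra_simps)
      also have "\<dots> \<le> exp (- \<beta> * \<bar>s\<bar>) * w2"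
        using hi by simp
      finally show ?thesis using w by (simp add: field_simps)
    qed
    then have f: "?f = (\<lambda>s. exp (- \<beta> * \<bar>s\<bar>) / w1)"
      by (intro ext max_absorb1)
    \<comment> \<open>This rules out the first branch of the conditional.\<close>
    have "exp (- \<beta> * t) * w1 \<le> exp (\<beta> * t) * w1"
      using \<beta> t w by (intro mult_right_mono) auto
    then show ?thesis
      unfolding f has_bochner_integral_integral_eq[OF I1] using hi \<beta> by simp
  next
    case mid
    \<comment> \<open>
      The two functions cross at \<open>c\<close>. Beyond \<open>c\<close> the smaller one is \<open>exp (- \<beta> * s) / w1\<close>, before
      \<open>c\<close> it is \<open>exp (- \<beta> * (t - s)) / w2\<close>. Both are one-sided exponentials, so the maximum is
      integrated as sum minus minimum.
    \<close>
    define c where "c = (\<beta> * t + ln (w2 / w1)) / (2 * \<beta>)"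
    have c: "\<beta> * (2 * c) = \<beta> * t + ln (w2 / w1)" using \<beta> by (simp add: c_def)
    \<comment> \<open>The case bounds confine the logarithm to an interval of radius
      \<open>\<beta> * t\<close> around 0, which places the crossing point between the peaks 0 and
      \<open>t\<close>.\<close>
    have "ln (w2 / w1) \<ge> - \<beta> * t" "ln (w2 / w1) < \<beta> * t"
      using mid w ln_less_cancel_iff[of "w2 / w1" "exp (\<beta> * t)"]
      by (simp_all add: ln_ge_iff field_simps)
    with c have "\<beta> * c \<ge> 0" "\<beta> * c \<le> \<beta> * t" by (auto simp: algebra_simps)
    then have c_bounds: "0 \<le> c" "c \<le> t" using \<beta> by (auto simp: zero_le_mult_iff)
    have cross: "exp (\<beta> * (2 * c - t)) = w2 / w1"
      using c w by (simp add: algebra_simps)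
    have T1: "has_bochner_integral lborel (\<lambda>s. indicator {c..} s * exp (- \<beta> * s) / w1) (exp (- \<beta> * c) / \<beta> / w1)"
      by (intro has_bochner_integral_divide_zero has_bochner_integral_exp_tail \<beta>)
    \<comment> \<open>The reflected indicator is that of \<open>s \<le> c\<close>.\<close>
    have T2: "has_bochner_integral lborel (\<lambda>s. indicator {t - c..} (t - s) * exp (- \<beta> * (t - s)) / w2)
        (exp (- \<beta> * (t - c)) / \<beta> / w2)"
      by (intro has_bochner_integral_divide_zero has_bochner_integral_reflect
          has_bochner_integral_exp_tail \<beta>)
    let ?g = "\<lambda>s. exp (- \<beta> * \<bar>s\<bar>) / w1 + exp (- \<beta> * \<bar>s - t\<bar>) / w2
        - (indicator {c..} s * exp (- \<beta> * s) / w1 + indicator {t - c..} (t - s) * exp (- \<beta> * (t - s)) / w2)"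
    have "(LBINT s. ?f s) = (LBINT s. ?g s)"
    proof (rule integral_cong_AE)
      \<comment> \<open>At \<open>s = c\<close> both indicators are 1 and \<open>?g\<close>
        subtracts both functions instead of the smaller one, so this point is excluded.\<close>
      show "AE s in lborel. ?f s = ?g s"
        using AE_lborel_singleton[of c]
      proof eventually_elim
        case (elim s)
        \<comment> \<open>The ratio of the two one-sided exponentials depends only on
          \<open>s - c\<close>, and its sign decides which of them is smaller.\<close>
        have key: "exp (- \<beta> * (t - s)) / w2 = exp (- \<beta> * s) / w1 * exp (2 * \<beta> * (s - c))"
        proof -
          have "w2 = w1 * exp (\<beta> * (2 * c - t))" using cross w by (simp add: field_simps)
          then show ?thesis using w
            by (simp add: field_simps exp_add[symmetric])
        qed
        consider "s < c" | "c < s" "s \<le> t" | "t < s" using elim by linarith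
        then show ?case
        proof cases
          case 1
          have "exp (- \<beta> * (t - s)) / w2 \<le> exp (- \<beta> * s) / w1"
            unfolding key using 1 \<beta> w by (intro mult_left_le) (auto simp: mult_nonneg_nonpos)
          \<comment> \<open>Left of both peaks the two functions are multiples of
            \<open>exp (\<beta> * s)\<close>, so the lower case bound compares their constants.
            Beyond \<open>t\<close> the upper case bound is used in the same way.\<close>
          moreover have "exp (- \<beta> * (t - s)) / w2 \<le> exp (- \<beta> * \<bar>s\<bar>) / w1" if "s < 0"
          proof -
            have "exp (- \<beta> * t) / w2 \<le> 1 / w1" using mid w by (simp add: field_simps)
            then have "exp (\<beta> * s) * (exp (- \<beta> * t) / w2) \<le> exp (\<beta> * s) * (1 / w1)"
              by (intro mult_left_mono) auto
            then show ?thesis using that by (simp add: exp_add[symmetric] algebra_simps)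
          qed
          ultimately have "exp (- \<beta> * (t - s)) / w2 \<le> exp (- \<beta> * \<bar>s\<bar>) / w1"
            by (cases "s < 0") auto
          then show ?thesis using 1 c_bounds by (auto simp: max_def algebra_simps)
        next
          case 2
          then have "exp (- \<beta> * s) / w1 * 1 \<le> exp (- \<beta> * (t - s)) / w2"
            unfolding key using \<beta> w by (intro mult_left_mono) auto
          then show ?thesis using 2 c_bounds by (auto simp: max_def algebra_simps)
        next
          case 3
          have "1 / w1 \<le> exp (\<beta> * t) / w2" using mid w by (simp add: field_simps)
          then have "exp (- \<beta> * s) * (1 / w1) \<le> exp (- \<beta> * s) * (exp (\<beta> * t) / w2)"
            by (intro mult_left_mono) auto
          then have "exp (- \<beta> * s) / w1 \<le> exp (- \<beta> * (s - t)) / w2"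
            by (simp add: exp_add[symmetric] algebra_simps)
          then show ?thesis using 3 c_bounds t by (auto simp: max_def algebra_simps)
        qed
      qed
    qed measurable
    also have "\<dots> = 2 / \<beta> / w1 + 2 / \<beta> / w2 - (exp (- \<beta> * c) / \<beta> / w1 + exp (- \<beta> * (t - c)) / \<beta> / w2)"
      by (intro has_bochner_integral_integral_eq has_bochner_integral_diff has_bochner_integral_add I1 I2 T1 T2)
    finally have I: "(LBINT s. ?f s) = \<dots>" .
    have V: "\<beta> / 2 * (LBINT s. ?f s)
        = 1 / w1 + 1 / w2 - (exp (- \<beta> * c) / w1 + exp (- \<beta> * (t - c)) / w2) / 2"
      unfolding I using \<beta> by (simp add: field_simps)
    \<comment> \<open>At the crossing the two functions share one value, which must be the square
      root of their product \<open>exp (- \<beta> * t) / (w1 * w2)\<close>. Each tail contributes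
      half of that value.\<close>
    have C1: "exp (- \<beta> * c) / w1 = exp (- \<beta> * t / 2) / sqrt (w1 * w2)"
    proof -
      have "exp (- \<beta> * c) = exp (- \<beta> * t / 2) * sqrt (w1 / w2)"
      proof -
        have "- \<beta> * c = - \<beta> * t / 2 + ln (w1 / w2) / 2"
          using c w by (simp add: ln_div field_simps)
        then show ?thesis using w by (simp only: exp_add exp_half_sqrt[of "ln (w1 / w2)"] exp_ln divide_pos_pos)
      qed
      then show ?thesis using w by (simp add: real_sqrt_divide real_sqrt_mult real_div_sqrt field_simps)
    qed
    have C2: "exp (- \<beta> * (t - c)) / w2 = exp (- \<beta> * t / 2) / sqrt (w1 * w2)"
    proof -
      have "exp (- \<beta> * (t - c)) = exp (- \<beta> * t / 2) * sqrt (w2 / w1)"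
      proof -
        have "- \<beta> * (t - c) = - \<beta> * t / 2 + ln (w2 / w1) / 2"
          using c by (simp add: field_simps)
        then show ?thesis using w by (simp only: exp_add exp_half_sqrt[of "ln (w2 / w1)"] exp_ln divide_pos_pos)
      qed
      moreover have "sqrt (w2 / w1) / w2 = 1 / sqrt (w1 * w2)"
        using w by (simp add: real_sqrt_divide real_sqrt_mult field_simps)
      ultimately show ?thesis by (metis times_divide_eq_right mult.right_neutral)
    qed
    show ?thesis using mid unfolding V C1 C2 by simp
  qed
qed

text \<open>The substitution of \<open>- s\<close> for \<open>s\<close> turns the integrand for
  \<open>t\<close> into the one for \<open>- t\<close>, so the nonnegative case suffices.\<close>

lemma integral_max_double_exp:
  fixes \<beta> t :: real
  assumes \<beta>: "0 < \<beta>" and w: "0 < w1" "0 < w2"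
  shows "\<beta> / 2 * (LBINT s. max (exp (- \<beta> * \<bar>s\<bar>) / w1) (exp (- \<beta> * \<bar>s - t\<bar>) / w2)) =
     (if w2 < exp (- \<beta> * \<bar>t\<bar>) * w1 then 1 / w2
      else if w2 < exp (\<beta> * \<bar>t\<bar>) * w1 then 1 / w1 + 1 / w2 - exp (- \<beta> * \<bar>t\<bar> / 2) / sqrt (w1 * w2)
      else 1 / w1)"
proof -
  let ?f = "\<lambda>t s. max (exp (- \<beta> * \<bar>s\<bar>) / w1) (exp (- \<beta> * \<bar>s - t\<bar>) / w2)"
  have "(LBINT s. ?f t s) = (LBINT s. ?f t (0 + -1 * s))"
    using lborel_integral_real_affine[of "-1" "?f t" 0] by simp
  also have "(\<lambda>s. ?f t (0 + -1 * s)) = ?f (- t)"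
  proof
    fix s
    show "?f t (0 + -1 * s) = ?f (- t) s"
      using abs_minus_cancel[of "s + t"] by simp
  qed
  finally have "(LBINT s. ?f t s) = (LBINT s. ?f \<bar>t\<bar> s)"
    by (cases "0 \<le> t") auto
  with integral_max_double_exp_nonneg[OF \<beta> _ w, of "\<bar>t\<bar>"] show ?thesis by simp
qed

section \<open>The integral over angles\<close>

lemma powr_minus_three_halves:
  fixes x :: real
  assumes "0 < x"
  shows "x powr (- 3 / 2) = 1 / (x * sqrt x)"
proof -
  have "x powr (- 3 / 2) = x powr (- (1 + 1 / 2))" by simp
  also have "\<dots> = inverse (x powr (1 + 1 / 2))" by (rule powr_minus)
  also have "x powr (1 + 1 / 2) = x * sqrt x"
    using assms by (subst powr_add) (simp add: powr_half_sqrt)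
  finally show ?thesis by (simp add: inverse_eq_divide)
qed

text \<open>These facts allow conditions on the angle to be restated for
  \<open>v = tan \<theta>\<close>, which runs from \<open>l\<close> to \<open>u\<close>.\<close>

lemma arctan_quadrant:
  assumes "0 < l" "arctan l \<le> \<theta>" "\<theta> \<le> arctan u"
  shows "0 < sin \<theta>" "0 < cos \<theta>" "l \<le> tan \<theta>" "tan \<theta> \<le> u"
    and "arctan (tan \<theta>) = \<theta>"
proof -
  have *: "0 < \<theta>" "\<theta> < pi / 2"
    using assms arctan_ubound[of u] zero_less_arctan_iff[of l] by linarith+
  then show "0 < sin \<theta>" "0 < cos \<theta>"
    by (auto intro!: sin_gt_zero cos_gt_zero)
  show at: "arctan (tan \<theta>) = \<theta>" using * by (intro arctan_tan) auto
  with assms show "l \<le> tan \<theta>" "tan \<theta> \<le> u"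
    using arctan_le_iff[of l "tan \<theta>"] arctan_le_iff[of "tan \<theta>" u] by simp_all
qed

text \<open>Under \<open>v = tan \<theta>\<close> the integrand becomes
  \<open>v powr (- 1 / 2)\<close>.\<close>

lemma has_integral_spectral_sin:
  fixes l u :: real
  assumes "0 < l" "l \<le> u"
  shows "((\<lambda>\<theta>. sin \<theta> * (sin \<theta> * cos \<theta>) powr (- 3 / 2)) has_integral (2 * sqrt u - 2 * sqrt l))
    {arctan l..arctan u}"
proof -
  have "((\<lambda>\<theta>. sin \<theta> * (sin \<theta> * cos \<theta>) powr (- 3 / 2)) has_integral
      (2 * sqrt (tan (arctan u)) - 2 * sqrt (tan (arctan l)))) {arctan l..arctan u}"
  proof (rule fundamental_theorem_of_calculus)
    fix \<theta> assume "\<theta> \<in> {arctan l..arctan u}"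
    then have q: "0 < sin \<theta>" "0 < cos \<theta>" using arctan_quadrant[OF assms(1)] by auto
    have D: "((\<lambda>\<theta>. sqrt (tan \<theta>)) has_real_derivative
        inverse (sqrt (tan \<theta>)) / 2 * inverse ((cos \<theta>)\<^sup>2)) (at \<theta>)"
      using q by (intro DERIV_chain2[OF DERIV_real_sqrt DERIV_tan]) (auto simp: tan_def)
    have eq: "2 * (inverse (sqrt (tan \<theta>)) / 2 * inverse ((cos \<theta>)\<^sup>2))
        = sin \<theta> * (sin \<theta> * cos \<theta>) powr (- 3 / 2)"
    proof -
      \<comment> \<open>Writing sine and cosine as squares of positive numbers removes all roots and
        leaves a rational identity.\<close>
      define a b where "a = sqrt (sin \<theta>)" and "b = sqrt (cos \<theta>)"
      then have ab: "0 < a" "0 < b" "sin \<theta> = a * a" "cos \<theta> = b * b"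
        using q by simp_all
      then have sq: "sqrt (a * a / (b * b)) = a / b" "sqrt (a * a * (b * b)) = a * b"
        by (simp_all add: real_sqrt_divide real_sqrt_mult)
      have "(a * a * (b * b)) powr (- 3 / 2) = 1 / (a * a * (b * b) * (a * b))"
        using ab(1,2) by (subst powr_minus_three_halves) (simp_all only: sq mult_pos_pos)
      then show ?thesis
        unfolding tan_def ab(3,4) sq using ab(1,2) by (simp add: field_simps power2_eq_square)
    qed
    have "((\<lambda>\<theta>. 2 * sqrt (tan \<theta>)) has_real_derivative sin \<theta> * (sin \<theta> * cos \<theta>) powr (- 3 / 2)) (at \<theta>)"
      using DERIV_cmult[OF D, of 2] unfolding eq .
    then show "((\<lambda>\<theta>. 2 * sqrt (tan \<theta>)) has_vector_derivative
        sin \<theta> * (sin \<theta> * cos \<theta>) powr (- 3 / 2)) (at \<theta> within {arctan l..arctan u})"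
      by (simp add: has_real_derivative_iff_has_vector_derivative has_vector_derivative_at_within)
  qed (use assms in \<open>simp add: arctan_le_iff\<close>)
  then show ?thesis by (simp add: tan_arctan)
qed

text \<open>Under \<open>v = tan \<theta>\<close> the integrand becomes
  \<open>v powr (- 3 / 2)\<close>.\<close>

lemma has_integral_spectral_cos:
  fixes l u :: real
  assumes "0 < l" "l \<le> u"
  shows "((\<lambda>\<theta>. cos \<theta> * (sin \<theta> * cos \<theta>) powr (- 3 / 2)) has_integral (2 / sqrt l - 2 / sqrt u))
    {arctan l..arctan u}"
proof -
  have "((\<lambda>\<theta>. cos \<theta> * (sin \<theta> * cos \<theta>) powr (- 3 / 2)) has_integral
      (- 2 * inverse (sqrt (tan (arctan u))) - - 2 * inverse (sqrt (tan (arctan l))))) {arctan l..arctan u}"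
  proof (rule fundamental_theorem_of_calculus)
    fix \<theta> assume "\<theta> \<in> {arctan l..arctan u}"
    then have q: "0 < sin \<theta>" "0 < cos \<theta>" using arctan_quadrant[OF assms(1)] by auto
    have D: "((\<lambda>\<theta>. sqrt (tan \<theta>)) has_real_derivative
        inverse (sqrt (tan \<theta>)) / 2 * inverse ((cos \<theta>)\<^sup>2)) (at \<theta>)"
      using q by (intro DERIV_chain2[OF DERIV_real_sqrt DERIV_tan]) (auto simp: tan_def)
    have nz: "sqrt (tan \<theta>) \<noteq> 0" using q by (simp add: tan_def)
    \<comment> \<open>The left side has the shape in which \<open>DERIV_inverse'\<close> and
      \<open>DERIV_cmult\<close> deliver the derivative.\<close>
    have eq: "- 2 * - (inverse (sqrt (tan \<theta>)) *
          (inverse (sqrt (tan \<theta>)) / 2 * inverse ((cos \<theta>)\<^sup>2)) * inverse (sqrt (tan \<theta>)))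
        = cos \<theta> * (sin \<theta> * cos \<theta>) powr (- 3 / 2)"
    proof -
      define a b where "a = sqrt (sin \<theta>)" and "b = sqrt (cos \<theta>)"
      then have ab: "0 < a" "0 < b" "sin \<theta> = a * a" "cos \<theta> = b * b"
        using q by simp_all
      then have sq: "sqrt (a * a / (b * b)) = a / b" "sqrt (a * a * (b * b)) = a * b"
        by (simp_all add: real_sqrt_divide real_sqrt_mult)
      have "(a * a * (b * b)) powr (- 3 / 2) = 1 / (a * a * (b * b) * (a * b))"
        using ab(1,2) by (subst powr_minus_three_halves) (simp_all only: sq mult_pos_pos)
      then show ?thesis
        unfolding tan_def ab(3,4) sq using ab(1,2) by (simp add: field_simps power2_eq_square)
    qed
    have "((\<lambda>\<theta>. - 2 * inverse (sqrt (tan \<theta>))) has_real_derivative cos \<theta> * (sin \<theta> * cos \<theta>) powr (- 3 / 2)) (at \<theta>)"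
      using DERIV_cmult[OF DERIV_inverse'[OF D nz], of "- 2"] unfolding eq .
    then show "((\<lambda>\<theta>. - 2 * inverse (sqrt (tan \<theta>))) has_vector_derivative
        cos \<theta> * (sin \<theta> * cos \<theta>) powr (- 3 / 2)) (at \<theta> within {arctan l..arctan u})"
      by (simp add: has_real_derivative_iff_has_vector_derivative has_vector_derivative_at_within)
  qed (use assms in \<open>simp add: arctan_le_iff\<close>)
  moreover have "- 2 * inverse (sqrt (tan (arctan u))) - - 2 * inverse (sqrt (tan (arctan l)))
      = 2 / sqrt l - 2 / sqrt u"
    by (simp add: tan_arctan divide_inverse)
  ultimately show ?thesis by (simp only:)
qed

text \<open>The split point \<open>r\<close> is kept abstract so that one formula covers all
  positions of \<open>w1 / w2\<close>: inside the interval \<open>r\<close> is that ratio, and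
  outside it \<open>r\<close> is an endpoint, where \<open>lo\<close> or \<open>hi\<close> becomes
  vacuous.\<close>

lemma spectral_integral:
  fixes \<beta> t l r u :: real
  assumes w: "0 < w1" "0 < w2" and l: "0 < l" "l \<le> r" "r \<le> u"
    and lo: "\<And>v. l \<le> v \<Longrightarrow> v < r \<Longrightarrow> v / w1 \<le> 1 / w2"
    and hi: "\<And>v. r < v \<Longrightarrow> v \<le> u \<Longrightarrow> 1 / w2 \<le> v / w1"
  shows "(LBINT \<theta>:{arctan l..arctan u}. max (sin \<theta> / w1) (cos \<theta> / w2) * spectral_density \<beta> t \<theta>)
    = exp (- \<beta> * \<bar>t\<bar> / 2) / 2 * (1 / w2 * (1 / sqrt l - 1 / sqrt r) + 1 / w1 * (sqrt u - sqrt r))"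
proof -
  let ?f = "\<lambda>\<theta>. max (sin \<theta> / w1) (cos \<theta> / w2) * spectral_density \<beta> t \<theta>"
  let ?C = "exp (- \<beta> * \<bar>t\<bar> / 2) / 4"
  have "0 < r" using l by simp
  have "sin \<theta> * cos \<theta> \<noteq> 0" if "\<theta> \<in> {arctan l..arctan u}" for \<theta>
    using arctan_quadrant(1,2)[OF l(1), of \<theta> u] that by auto
  then have "continuous_on {arctan l..arctan u} ?f"
    unfolding spectral_density_def
    by (intro continuous_on_mult continuous_on_max continuous_on_divide continuous_on_sin
        continuous_on_cos continuous_on_powr continuous_on_const continuous_on_id)
      (use w in auto)
  then have "set_integrable lborel {arctan l..arctan u} ?f"
    by (rule borel_integrable_atLeastAtMost')
  then have "(LBINT \<theta>:{arctan l..arctan u}. ?f \<theta>) = integral {arctan l..arctan u} ?f"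
    by (rule set_borel_integral_eq_integral(2))
  also have "integral {arctan l..arctan u} ?f
      = ?C / w2 * (2 / sqrt l - 2 / sqrt r) + ?C / w1 * (2 * sqrt u - 2 * sqrt r)"
  proof (rule integral_unique, rule has_integral_combine)
    \<comment> \<open>The assumptions compare the two terms only strictly on either side of
      \<open>r\<close>, hence the single angle \<open>arctan r\<close> is discarded.\<close>
    show "(?f has_integral ?C / w2 * (2 / sqrt l - 2 / sqrt r)) {arctan l..arctan r}"
    proof (rule has_integral_spike_finite[OF _ _ has_integral_mult_right[OF has_integral_spectral_cos[OF l(1,2)]], of "{arctan r}"])
      fix \<theta> assume "\<theta> \<in> {arctan l..arctan r} - {arctan r}"
      then have q: "0 < sin \<theta>" "0 < cos \<theta>" "l \<le> tan \<theta>" "tan \<theta> < r"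
        using arctan_quadrant[OF l(1), of \<theta> r] by (auto simp: less_le)
      have "sin \<theta> / w1 \<le> cos \<theta> / w2"
        using lo[OF q(3,4)] q w by (simp add: tan_def field_simps)
      then show "?f \<theta> = ?C / w2 * (cos \<theta> * (sin \<theta> * cos \<theta>) powr (- 3 / 2))"
        unfolding spectral_density_def
        by (simp only: max_absorb2 times_divide_eq_left times_divide_eq_right divide_divide_eq_left mult_ac)
    qed simp
    show "(?f has_integral ?C / w1 * (2 * sqrt u - 2 * sqrt r)) {arctan r..arctan u}"
    proof (rule has_integral_spike_finite[OF _ _ has_integral_mult_right[OF has_integral_spectral_sin[OF \<open>0 < r\<close> l(3)]], of "{arctan r}"])
      fix \<theta> assume "\<theta> \<in> {arctan r..arctan u} - {arctan r}"
      then have q: "0 < sin \<theta>" "0 < cos \<theta>" "r < tan \<theta>" "tan \<theta> \<le> u"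
        using arctan_quadrant[OF \<open>0 < r\<close>, of \<theta> u] by (auto simp: less_le)
      have "cos \<theta> / w2 \<le> sin \<theta> / w1"
        using hi[OF q(3,4)] q w by (simp add: tan_def field_simps)
      then show "?f \<theta> = ?C / w1 * (sin \<theta> * (sin \<theta> * cos \<theta>) powr (- 3 / 2))"
        unfolding spectral_density_def
        by (simp only: max_absorb1 times_divide_eq_left times_divide_eq_right divide_divide_eq_left mult_ac)
    qed simp
  qed (use l in \<open>simp_all add: arctan_le_iff\<close>)
  also have "\<dots> = ?C / w2 * (2 * (1 / sqrt l - 1 / sqrt r)) + ?C / w1 * (2 * (sqrt u - sqrt r))"
    by (simp only: right_diff_distrib times_divide_eq_right mult.right_neutral)
  also have "E / 4 / w2 * (2 * x) + E / 4 / w1 * (2 * y) = E / 2 * (1 / w2 * x + 1 / w1 * y)" for E x y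
    by (simp add: distrib_left)
  finally show ?thesis .
qed

lemma nn_integral_double_exponential_density:
  assumes "0 < \<beta>"
  shows "(\<integral>\<^sup>+x. ennreal (double_exponential_density \<beta> x) \<partial>lborel) = 1"
proof -
  have I: "has_bochner_integral lborel (double_exponential_density \<beta>) 1"
    using has_bochner_integral_mult_right[OF has_bochner_integral_double_exp[OF assms, of 0], of "\<beta> / 2"] assms
    by (simp add: double_exponential_density_def[abs_def])
  have "(\<integral>\<^sup>+x. ennreal (double_exponential_density \<beta> x) \<partial>lborel)
      = ennreal (LBINT x. double_exponential_density \<beta> x)"
  proof (intro nn_integral_eq_integral AE_I2)
    show "integrable lborel (double_exponential_density \<beta>)"
      using I by (rule integrable.intros)
  qed (use assms in \<open>simp add: double_exponential_density_def\<close>)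
  then show ?thesis
    using has_bochner_integral_integral_eq[OF I] by simp
qed

text \<open>The two \<open>max\<close> terms are contributions of point masses in the directions of
  the lower and upper endpoint angles. The cases record where \<open>w1 / w2\<close>, the tangent at
  which the maximum switches, lies relative to the interval of tangents.\<close>

lemma spectral_representation:
  fixes \<beta> t :: real
  assumes \<beta>: "0 < \<beta>" and w: "0 < w1" "0 < w2"
  shows "(LBINT \<theta>:{arctan (exp (- \<beta> * \<bar>t\<bar>))..arctan (exp (\<beta> * \<bar>t\<bar>))}.
              max (sin \<theta> / w1) (cos \<theta> / w2) * spectral_density \<beta> t \<theta>)
          + 1 / 2 * max (exp (- \<beta> * \<bar>t\<bar>) / w1) (1 / w2)
          + 1 / 2 * max (1 / w1) (exp (- \<beta> * \<bar>t\<bar>) / w2)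
    = (if w2 < exp (- \<beta> * \<bar>t\<bar>) * w1 then 1 / w2
       else if w2 < exp (\<beta> * \<bar>t\<bar>) * w1 then 1 / w1 + 1 / w2 - exp (- \<beta> * \<bar>t\<bar> / 2) / sqrt (w1 * w2)
       else 1 / w1)"
proof -
  \<comment> \<open>With \<open>q\<close> the exponentials and the roots of the endpoints become
    rational expressions.\<close>
  define q where "q = exp (\<beta> * \<bar>t\<bar> / 2)"
  have q: "1 \<le> q" "0 < q" using \<beta> by (simp_all add: q_def)
  have e: "exp (\<beta> * \<bar>t\<bar>) = q * q" "exp (- \<beta> * \<bar>t\<bar>) = 1 / (q * q)" "exp (- \<beta> * \<bar>t\<bar> / 2) = 1 / q"
    by (simp_all add: q_def exp_add[symmetric] exp_minus inverse_eq_divide)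
  have qq: "1 \<le> q * q" using q mult_mono[of 1 q 1 q] by simp
  have lu: "0 < 1 / (q * q)" "1 / (q * q) \<le> q * q"
    using q qq order_trans[of "1 / (q * q)" 1 "q * q"] by simp_all
  have sq: "sqrt (q * q) = q" "sqrt (1 / (q * q)) = 1 / q"
    using q by (simp_all add: real_sqrt_divide)
  note S = spectral_integral[OF w lu(1), where u = "q * q" and \<beta> = \<beta> and t = t, unfolded e(3) sq]
  let ?I = "LBINT \<theta>:{arctan (1 / (q * q))..arctan (q * q)}.
      max (sin \<theta> / w1) (cos \<theta> / w2) * spectral_density \<beta> t \<theta>"
  have mono: "x \<le> q * q * x" if "0 < x" for x
    using qq that by simp
  consider (lo) "q * q * w2 < w1" | (hi) "q * q * w1 \<le> w2"
    | (mid) "w1 \<le> q * q * w2" "w2 < q * q * w1" by linarith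
  then have "?I + 1 / 2 * max (1 / (q * q) / w1) (1 / w2) + 1 / 2 * max (1 / w1) (1 / (q * q) / w2)
    = (if q * q * w2 < w1 then 1 / w2
       else if w2 < q * q * w1 then 1 / w1 + 1 / w2 - 1 / q / sqrt (w1 * w2) else 1 / w1)"
  proof cases
    case lo
    \<comment> \<open>The switch lies beyond the upper endpoint: the cosine term wins throughout,
      and \<open>r\<close> is that endpoint.\<close>
    have "v / w1 \<le> 1 / w2" if "v < q * q" for v
    proof -
      have "v * w2 \<le> q * q * w2" using that w by simp
      also note lo
      finally show ?thesis using w by (simp add: field_simps)
    qed
    then have I: "?I = 1 / q / 2 * (1 / w2 * (1 / (1 / q) - 1 / q))"
      using S[of "q * q"] lu sq by simp
    have "w2 < q * q * w1" using lo mono[OF w(1)] mono[OF w(2)] by linarith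
    then have M: "max (1 / (q * q) / w1) (1 / w2) = 1 / w2" "max (1 / w1) (1 / (q * q) / w2) = 1 / (q * q) / w2"
      using lo w q by (auto simp: max_def field_simps)
    show ?thesis unfolding I M using lo q w by (simp add: field_simps)
  next
    case hi
    \<comment> \<open>The switch does not lie above the lower endpoint: the sine term wins
      throughout, and \<open>r\<close> is that endpoint.\<close>
    have "1 / w2 \<le> v / w1" if "1 / (q * q) < v" for v
    proof -
      have "w1 \<le> w2 * (1 / (q * q))" using hi q by (simp add: field_simps)
      also have "\<dots> \<le> w2 * v" using that w by (intro mult_left_mono) simp_all
      finally show ?thesis using w by (simp add: field_simps)
    qed
    then have I: "?I = 1 / q / 2 * (1 / w1 * (q - 1 / q))"
      using S[of "1 / (q * q)"] lu sq by simp
    have l: "w1 \<le> q * q * w2" using hi mono[OF w(1)] mono[OF w(2)] by linarith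
    then have M: "max (1 / (q * q) / w1) (1 / w2) = 1 / (q * q) / w1" "max (1 / w1) (1 / (q * q) / w2) = 1 / w1"
      using hi w q by (auto simp: max_def field_simps)
    show ?thesis unfolding I M using hi l q w by (simp add: field_simps)
  next
    case mid
    have r: "1 / (q * q) \<le> w1 / w2" "w1 / w2 \<le> q * q"
      using mid w q by (simp_all add: field_simps)
    have I: "?I = 1 / q / 2 * (1 / w2 * (1 / (1 / q) - 1 / sqrt (w1 / w2)) + 1 / w1 * (q - sqrt (w1 / w2)))"
      using w by (intro S r) (simp_all add: field_simps)
    have M: "max (1 / (q * q) / w1) (1 / w2) = 1 / w2" "max (1 / w1) (1 / (q * q) / w2) = 1 / w1"
      using mid w q by (auto simp: max_def field_simps)
    have R: "1 / w2 * (1 / sqrt (w1 / w2)) = 1 / sqrt (w1 * w2)" "1 / w1 * sqrt (w1 / w2) = 1 / sqrt (w1 * w2)"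
      using w by (simp_all add: real_sqrt_divide real_sqrt_mult field_simps)
    have "?I = 1 / q / 2 * (q / w2 + q / w1 - (1 / w2 * (1 / sqrt (w1 / w2)) + 1 / w1 * sqrt (w1 / w2)))"
      unfolding I by (simp add: algebra_simps)
    then have "?I = 1 / q / 2 * (q / w2 + q / w1 - 2 * (1 / sqrt (w1 * w2)))"
      unfolding R by simp
    then have "?I = 1 / w2 / 2 + 1 / w1 / 2 - 1 / q / sqrt (w1 * w2)"
      using q by (simp add: distrib_left right_diff_distrib)
    then show ?thesis unfolding M using mid by simp
  qed
  moreover have "w2 < 1 / (q * q) * w1 \<longleftrightarrow> q * q * w2 < w1"
    using q by (simp add: field_simps)
  ultimately show ?thesis
    unfolding e by (simp only:)
qed

text \<open>The pieces of \<open>chi\<close> are closed on the right, those of the closed form on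
  the left. The two boundary values are therefore separate cases, where adjacent formulas have to
  agree.\<close>

lemma chi_representation:
  fixes \<beta> t :: real
  assumes \<beta>: "0 < \<beta>" and w: "0 < w1" "0 < w2"
  shows "1 / w1 + 1 / w2 + 1 / w2 * chi \<beta> t (w2 / w1)
    = (if w2 < exp (- \<beta> * \<bar>t\<bar>) * w1 then 1 / w2
       else if w2 < exp (\<beta> * \<bar>t\<bar>) * w1 then 1 / w1 + 1 / w2 - exp (- \<beta> * \<bar>t\<bar> / 2) / sqrt (w1 * w2)
       else 1 / w1)"
proof -
  define q where "q = exp (\<beta> * \<bar>t\<bar> / 2)"
  have q: "1 \<le> q" "0 < q" using \<beta> by (simp_all add: q_def)
  have e: "exp (\<beta> * \<bar>t\<bar>) = q * q" "exp (- \<beta> * \<bar>t\<bar>) = 1 / (q * q)" "exp (- \<beta> * \<bar>t\<bar> / 2) = 1 / q"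
    by (simp_all add: q_def exp_add[symmetric] exp_minus inverse_eq_divide)
  have qq: "1 \<le> q * q" using q mult_mono[of 1 q 1 q] by simp
  have R: "1 / w2 * sqrt (w2 / w1) = 1 / sqrt (w1 * w2)"
    using w by (simp add: real_sqrt_divide real_sqrt_mult field_simps)
  have lo: "w2 / w1 \<le> 1 / (q * q) \<longleftrightarrow> q * q * w2 \<le> w1" "w2 < 1 / (q * q) * w1 \<longleftrightarrow> q * q * w2 < w1"
    and hi: "w2 / w1 \<le> q * q \<longleftrightarrow> w2 \<le> q * q * w1"
    using w q by (simp_all add: field_simps)
  have mono: "x \<le> q * q * x" if "0 < x" for x
    using qq that by simp
  consider (lo) "q * q * w2 < w1" | (lo_eq) "q * q * w2 = w1"
    | (mid) "w1 < q * q * w2" "w2 < q * q * w1" | (hi_eq) "w1 < q * q * w2" "w2 = q * q * w1"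
    | (hi) "w1 < q * q * w2" "q * q * w1 < w2" by linarith
  then have "1 / w1 + 1 / w2 + 1 / w2 * (if q * q * w2 \<le> w1 then - (w2 / w1)
        else if w2 \<le> q * q * w1 then - (1 / q) * sqrt (w2 / w1) else - 1)
      = (if q * q * w2 < w1 then 1 / w2
         else if w2 < q * q * w1 then 1 / w1 + 1 / w2 - 1 / q / sqrt (w1 * w2) else 1 / w1)"
  proof cases
    case lo
    then show ?thesis
      using w by simp
  next
    case lo_eq
    have "w2 \<le> w1" "w1 \<le> q * q * w1" using lo_eq mono w by auto
    moreover have "sqrt (w1 * w2) = q * w2"
      unfolding lo_eq[symmetric] using q w by (intro real_sqrt_unique) (auto simp: power2_eq_square)
    moreover have "1 / q / (q * w2) = 1 / w1"
      unfolding lo_eq[symmetric] by simp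
    \<comment> \<open>If \<open>q = 1\<close>, that is \<open>t = 0\<close>, the middle range is
      empty and the last branch applies with \<open>w2 = w1\<close>.\<close>
    moreover have "w2 < q * q * w1 \<or> w2 = w1 \<and> \<not> w2 < q * q * w1"
      using calculation(1,2) by linarith
    moreover have "q * q * w2 \<le> w1" "\<not> q * q * w2 < w1" using lo_eq by simp_all
    ultimately show ?thesis
      using w by (elim disjE conjE) simp_all
  next
    case mid
    then show ?thesis
      using R q by (simp add: field_simps)
  next
    case hi_eq
    moreover have "sqrt (w2 / w1) = q"
      unfolding hi_eq(2) using q w by simp
    ultimately show ?thesis
      using q by simp
  next
    case hi
    then show ?thesis
      by simp
  qed
  then show ?thesis
    unfolding chi_def e lo hi .
qed

theorem proposition2p1:
  fixes M :: "'w measure" and X Y :: "nat \<Rightarrow> 'w \<Rightarrow> real"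
    and Z :: "real \<Rightarrow> 'w \<Rightarrow> real" and \<beta> t w1 w2 :: real
  assumes "\<beta> > 0"
    and "unit_poisson_half_plane M X Y"
    and "Z = moving_maximum (double_exponential_density \<beta>) X Y"
    and "w1 > 0" and "w2 > 0"
  shows "let V = - ln (measure M {\<omega> \<in> space M. Z 0 \<omega> \<le> w1 \<and> Z t \<omega> \<le> w2}) in
      V = \<beta> / 2 * (LBINT s. max (exp (- \<beta> * \<bar>s\<bar>) / w1) (exp (- \<beta> * \<bar>s - t\<bar>) / w2))
    \<and> V = (if w2 < exp (- \<beta> * \<bar>t\<bar>) * w1 then 1 / w2
           else if w2 < exp (\<beta> * \<bar>t\<bar>) * w1
             then 1 / w1 + 1 / w2 - exp (- \<beta> * \<bar>t\<bar> / 2) / sqrt (w1 * w2)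
           else 1 / w1)
    \<and> V = (LBINT \<theta>:{arctan (exp (- \<beta> * \<bar>t\<bar>))..arctan (exp (\<beta> * \<bar>t\<bar>))}.
              max (sin \<theta> / w1) (cos \<theta> / w2) * spectral_density \<beta> t \<theta>)
          + 1 / 2 * max (exp (- \<beta> * \<bar>t\<bar>) / w1) (1 / w2)
          + 1 / 2 * max (1 / w1) (exp (- \<beta> * \<bar>t\<bar>) / w2)
    \<and> V = 1 / w1 + 1 / w2 + 1 / w2 * chi \<beta> t (w2 / w1)"
proof -
  let ?\<phi> = "double_exponential_density \<beta>"
  have \<phi>: "?\<phi> \<in> borel_measurable borel" "\<And>x. 0 \<le> ?\<phi> x" "(\<integral>\<^sup>+x. ennreal (?\<phi> x) \<partial>lborel) = 1"
    using assms(1) nn_integral_double_exponential_density[OF assms(1)]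
    by (simp_all add: double_exponential_density_def[abs_def])
  have "- ln (measure M {\<omega> \<in> space M. Z 0 \<omega> \<le> w1 \<and> Z t \<omega> \<le> w2})
      = (LBINT s. max (?\<phi> (s - 0) / w1) (?\<phi> (s - t) / w2))"
    unfolding assms(3) prob_moving_maximum_le[OF assms(2) \<phi> assms(4,5)] by simp
  also have "(\<lambda>s. max (?\<phi> (s - 0) / w1) (?\<phi> (s - t) / w2))
      = (\<lambda>s. \<beta> / 2 * max (exp (- \<beta> * \<bar>s\<bar>) / w1) (exp (- \<beta> * \<bar>s - t\<bar>) / w2))"
    using assms(1) by (simp add: double_exponential_density_def max_mult_distrib_left)
  finally have V: "- ln (measure M {\<omega> \<in> space M. Z 0 \<omega> \<le> w1 \<and> Z t \<omega> \<le> w2})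
      = \<beta> / 2 * (LBINT s. max (exp (- \<beta> * \<bar>s\<bar>) / w1) (exp (- \<beta> * \<bar>s - t\<bar>) / w2))"
    by simp
  \<comment> \<open>Rewriting turns the spectral and \<open>chi\<close> expressions into the closed
    form, so every conjunct after the first is the same equation.\<close>
  show ?thesis
    unfolding Let_def spectral_representation[OF assms(1,4,5)] chi_representation[OF assms(1,4,5)]
    by (intro conjI V trans[OF V integral_max_double_exp[OF assms(1,4,5)]])
qed

end
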